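(* Let $k$ be a field, $n\in\mathbb N$ and $k[\bar X]=k[X_1,\ldots,X_n]$. The map $I\mapsto \mathcal Z(I)$ induces an order-reversing bijection between essential ideals of $k[\bar X]$ and algebraic subsets of $k^n$, between essential prime ideals of $k[\bar X]$ and irreducible algebraic subsets of $k^n$, and between essential maximal ideals of $k[\bar X]$ and points of $k^n$.
   Context: $k$ is an arbitrary field. For an ideal $I$ of $k[X_1,\ldots,X_n]$, $\mathcal Z(I)=\{P\in k^n : \forall f\in I,\ f(P)=0\}$; the sets of this form are the algebraic subsets of $k^n$, the closed sets of the Zariski topology on $k^n$. Irreducible sets are nonempty; points $P$ are identified with the algebraic subsets $\{P\}$. A maximal ideal $\mathfrak m$ of a $k$-algebra $A$ is essential if the structural morphism $k\to A/\mathfrak m$ is an isomorphism. The equiradical $\sqrt[e]{I}$ of an ideal $I$ of $A$ is the intersection of all essential maximal ideals of $A$ containing $I$ (equal to $A$ if there are none). An ideal $I$ of $A$ is essential if $I=\sqrt[e]{I}$ (for maximal ideals, both notions of essential agree). *)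

theory Defs
  imports
    "HOL-Library.Poly_Mapping"
    "HOL-Algebra.Algebraic_Closure_Type"
    "HOL-Analysis.Abstract_Topology"
begin

section \<open>Essential ideals of a \<open>k\<close>-algebra\<close>

text \<open>The structural morphism of a \<open>K\<close>-algebra \<open>A\<close> sends \<open>c\<close> to \<open>c \<odot> 1\<close>; below it is composed
  with the projection onto \<open>A/m\<close>.\<close>

definition essential_maximal ::
  "('k, 'c) ring_scheme \<Rightarrow> ('k, 'a, 'd) module_scheme \<Rightarrow> 'a set \<Rightarrow> bool" where
  "essential_maximal K A m \<longleftrightarrow> maximalideal m A \<and>
     (\<lambda>c. m +>\<^bsub>A\<^esub> (c \<odot>\<^bsub>A\<^esub> \<one>\<^bsub>A\<^esub>)) \<in> ring_iso K (A Quot m)"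

text \<open>The intersection with the carrier makes the equiradical equal to \<open>A\<close> when no essential
  maximal ideal contains \<open>I\<close>.\<close>

definition equiradical ::
  "('k, 'c) ring_scheme \<Rightarrow> ('k, 'a, 'd) module_scheme \<Rightarrow> 'a set \<Rightarrow> 'a set" where
  "equiradical K A I = carrier A \<inter> \<Inter> {m. essential_maximal K A m \<and> I \<subseteq> m}"

definition essential_ideal ::
  "('k, 'c) ring_scheme \<Rightarrow> ('k, 'a, 'd) module_scheme \<Rightarrow> 'a set \<Rightarrow> bool" where
  "essential_ideal K A I \<longleftrightarrow> ideal I A \<and> I = equiradical K A I"

text \<open>For maximal ideals the two notions of essential agree.\<close>

lemma essential_maximal_iff_essential_ideal:
  assumes m: "maximalideal m A"
  shows "essential_maximal K A m \<longleftrightarrow> essential_ideal K A m"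
proof -
  interpret maximalideal m A by (fact m)
  have sub: "m \<subseteq> carrier A" by (rule a_subset)
  have eq: "m' = m" if "essential_maximal K A m'" "m \<subseteq> m'" for m'
  proof -
    interpret m': maximalideal m' A using that by (simp add: essential_maximal_def)
    show ?thesis
      using I_maximal[OF m'.ideal_axioms that(2) m'.a_subset] m'.I_notcarr by blast
  qed
  show ?thesis
  proof
    assume "essential_maximal K A m"
    then show "essential_ideal K A m"
      using eq sub ideal_axioms by (auto simp: essential_ideal_def equiradical_def)
  next
    assume "essential_ideal K A m"
    then have "m = equiradical K A m" by (simp add: essential_ideal_def)
    then obtain m' where "essential_maximal K A m'" "m \<subseteq> m'"
      using I_notcarr unfolding equiradical_def by blast
    then show "essential_maximal K A m" using eq by blast
  qed
qed


section \<open>The polynomial algebra \<open>k[X\<^sub>1,\<dots>,X\<^sub>n]\<close>\<close>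

text \<open>Exponent vectors and polynomials are finitely supported maps. The variables are indexed
  by \<open>nat\<close>, and \<open>k[X\<^sub>1,\<dots>,X\<^sub>n]\<close> is the subalgebra of the polynomials in which only the variables
  with index in \<open>{..<n}\<close> occur.\<close>

type_synonym 'k mpoly = "(nat \<Rightarrow>\<^sub>0 nat) \<Rightarrow>\<^sub>0 'k"

definition mpoly_carrier :: "nat \<Rightarrow> 'k::field mpoly set" where
  "mpoly_carrier n = {f. \<forall>a \<in> Poly_Mapping.keys f. Poly_Mapping.keys a \<subseteq> {..<n}}"

definition mpoly_algebra :: "nat \<Rightarrow> ('k::field, 'k mpoly) module" where
  "mpoly_algebra n = \<lparr>carrier = mpoly_carrier n, monoid.mult = (*), one = 1, ring.zero = 0,
     add = (+), module.smult = (\<lambda>c f. Poly_Mapping.single 0 c * f)\<rparr>"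

lemma mpoly_algebra_simps [simp]:
  "carrier (mpoly_algebra n) = mpoly_carrier n"
  "f \<otimes>\<^bsub>mpoly_algebra n\<^esub> g = f * g"
  "\<one>\<^bsub>mpoly_algebra n\<^esub> = 1"
  "\<zero>\<^bsub>mpoly_algebra n\<^esub> = 0"
  "f \<oplus>\<^bsub>mpoly_algebra n\<^esub> g = f + g"
  "c \<odot>\<^bsub>mpoly_algebra n\<^esub> f = Poly_Mapping.single 0 c * f"
  by (simp_all add: mpoly_algebra_def)

lemma mpoly_carrier_const: "Poly_Mapping.single 0 c \<in> mpoly_carrier n"
  by (simp add: mpoly_carrier_def)

lemma mpoly_carrier_1: "1 \<in> mpoly_carrier n"
  using mpoly_carrier_const[of 1 n] by simp

lemma mpoly_carrier_0: "0 \<in> mpoly_carrier n"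
  by (simp add: mpoly_carrier_def)

lemma mpoly_carrier_add: "f \<in> mpoly_carrier n \<Longrightarrow> g \<in> mpoly_carrier n \<Longrightarrow> f + g \<in> mpoly_carrier n"
  using Poly_Mapping.keys_add[of f g] unfolding mpoly_carrier_def by blast

lemma mpoly_carrier_uminus: "f \<in> mpoly_carrier n \<Longrightarrow> - f \<in> mpoly_carrier n"
  by (simp add: mpoly_carrier_def in_keys_iff)

lemma mpoly_carrier_mult:
  assumes "f \<in> mpoly_carrier n" "g \<in> mpoly_carrier n"
  shows "f * g \<in> mpoly_carrier n"
  unfolding mpoly_carrier_def
proof (intro CollectI ballI)
  fix a assume "a \<in> Poly_Mapping.keys (f * g)"
  then obtain b c where "a = b + c" "b \<in> Poly_Mapping.keys f" "c \<in> Poly_Mapping.keys g"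
    using keys_mult[of f g] by blast
  then show "Poly_Mapping.keys a \<subseteq> {..<n}"
    using assms Poly_Mapping.keys_add[of b c] unfolding mpoly_carrier_def by blast
qed

lemmas mpoly_carrier_closed =
  mpoly_carrier_const mpoly_carrier_0 mpoly_carrier_1 mpoly_carrier_add mpoly_carrier_uminus
  mpoly_carrier_mult

lemma cring_mpoly_algebra: "cring (mpoly_algebra n)"
proof (rule cringI)
  show "abelian_group (mpoly_algebra n)"
  proof (rule abelian_groupI)
    fix x assume "x \<in> carrier (mpoly_algebra n)"
    then show "\<exists>y\<in>carrier (mpoly_algebra n). y \<oplus>\<^bsub>mpoly_algebra n\<^esub> x = \<zero>\<^bsub>mpoly_algebra n\<^esub>"
      by (intro bexI[of _ "- x"]) (auto simp: mpoly_carrier_closed)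
  qed (auto simp: mpoly_carrier_closed algebra_simps)
  show "Group.comm_monoid (mpoly_algebra n)"
    by (rule comm_monoidI) (auto simp: mpoly_carrier_closed algebra_simps)
qed (auto simp: algebra_simps)

lemma algebra_mpoly_algebra: "algebra ring_of_type_algebra (mpoly_algebra n)"
proof (rule algebraI)
  show "cring (ring_of_type_algebra :: 'a ring)" by (rule cring_from_type_algebra)
qed (auto simp: ring_of_type_algebra_def cring_mpoly_algebra mpoly_carrier_closed single_add
      mult_single algebra_simps simp flip: mult.assoc)


section \<open>Algebraic sets and the Zariski topology\<close>

definition affine_points :: "nat \<Rightarrow> (nat \<Rightarrow> 'k) set" where
  "affine_points n = {..<n} \<rightarrow>\<^sub>E UNIV"

definition mpoly_eval :: "'k::field mpoly \<Rightarrow> (nat \<Rightarrow> 'k) \<Rightarrow> 'k" where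
  "mpoly_eval f P = (\<Sum>a \<in> Poly_Mapping.keys f.
     Poly_Mapping.lookup f a * (\<Prod>i \<in> Poly_Mapping.keys a. P i ^ Poly_Mapping.lookup a i))"

definition zero_locus :: "nat \<Rightarrow> 'k::field mpoly set \<Rightarrow> (nat \<Rightarrow> 'k) set" where
  "zero_locus n I = {P \<in> affine_points n. \<forall>f \<in> I. mpoly_eval f P = 0}"

definition algebraic_subset :: "nat \<Rightarrow> (nat \<Rightarrow> 'k::field) set \<Rightarrow> bool" where
  "algebraic_subset n V \<longleftrightarrow> (\<exists>I. ideal I (mpoly_algebra n) \<and> V = zero_locus n I)"

definition zariski :: "nat \<Rightarrow> (nat \<Rightarrow> 'k::field) topology" where
  "zariski n = topology (\<lambda>U. U \<subseteq> affine_points n \<and> algebraic_subset n (affine_points n - U))"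

definition irreducible_in :: "'a topology \<Rightarrow> 'a set \<Rightarrow> bool" where
  "irreducible_in T S \<longleftrightarrow> S \<subseteq> topspace T \<and> S \<noteq> {} \<and>
     (\<forall>C D. closedin (subtopology T S) C \<and> closedin (subtopology T S) D \<and> S = C \<union> D
        \<longrightarrow> S = C \<or> S = D)"

definition order_reversing_bij_betw :: "('a set \<Rightarrow> 'b set) \<Rightarrow> 'a set set \<Rightarrow> 'b set set \<Rightarrow> bool" where
  "order_reversing_bij_betw F \<A> \<B> \<longleftrightarrow> bij_betw F \<A> \<B> \<and>
     (\<forall>I \<in> \<A>. \<forall>J \<in> \<A>. I \<subseteq> J \<longleftrightarrow> F J \<subseteq> F I)"


text \<open>The family in the definition of \<^const>\<open>zariski\<close> is indeed a topology, so that the closed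
  sets are the algebraic subsets.\<close>

lemma mpoly_eval_superset:
  assumes "finite S" "Poly_Mapping.keys f \<subseteq> S"
  shows "mpoly_eval f P = (\<Sum>a \<in> S.
     Poly_Mapping.lookup f a * (\<Prod>i \<in> Poly_Mapping.keys a. P i ^ Poly_Mapping.lookup a i))"
  unfolding mpoly_eval_def using assms
  by (intro sum.mono_neutral_left) (auto simp: in_keys_iff)

lemma mpoly_eval_add: "mpoly_eval (f + g) P = mpoly_eval f P + mpoly_eval g P"
proof -
  let ?S = "Poly_Mapping.keys f \<union> Poly_Mapping.keys g"
  show ?thesis
    using Poly_Mapping.keys_add[of f g]
    by (simp add: mpoly_eval_superset[of ?S] lookup_add distrib_right sum.distrib)
qed

lemma mpoly_eval_0 [simp]: "mpoly_eval 0 P = 0"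
  by (simp add: mpoly_eval_def)

lemma mpoly_eval_sum: "mpoly_eval (sum f S) P = (\<Sum>s\<in>S. mpoly_eval (f s) P)"
  by (induction S rule: infinite_finite_induct) (simp_all add: mpoly_eval_add)

lemma mpoly_eval_single: "mpoly_eval (Poly_Mapping.single a c) P =
    c * (\<Prod>i \<in> Poly_Mapping.keys a. P i ^ Poly_Mapping.lookup a i)"
  by (subst mpoly_eval_superset[of "{a}"]) auto

lemma mpoly_as_sum:
  "f = (\<Sum>a\<in>Poly_Mapping.keys f. Poly_Mapping.single a (Poly_Mapping.lookup f a))"
proof (rule poly_mapping_eqI)
  fix k
  show "Poly_Mapping.lookup f k = Poly_Mapping.lookup
    (\<Sum>a\<in>Poly_Mapping.keys f. Poly_Mapping.single a (Poly_Mapping.lookup f a)) k"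
    by (simp add: lookup_sum lookup_single when_def in_keys_iff)
qed

lemma monomial_eval_add:
  fixes P :: "nat \<Rightarrow> 'k::field"
  shows "(\<Prod>i \<in> Poly_Mapping.keys (a + b). P i ^ Poly_Mapping.lookup (a + b) i) =
    (\<Prod>i \<in> Poly_Mapping.keys a. P i ^ Poly_Mapping.lookup a i) *
    (\<Prod>i \<in> Poly_Mapping.keys b. P i ^ Poly_Mapping.lookup b i)"
proof -
  let ?S = "Poly_Mapping.keys a \<union> Poly_Mapping.keys b"
  have *: "(\<Prod>i \<in> Poly_Mapping.keys c. P i ^ Poly_Mapping.lookup c i) =
      (\<Prod>i \<in> ?S. P i ^ Poly_Mapping.lookup c i)" if "Poly_Mapping.keys c \<subseteq> ?S" for c
    using that by (intro prod.mono_neutral_left) (auto simp: in_keys_iff)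
  show ?thesis
    unfolding *[OF Poly_Mapping.keys_add] *[OF Un_upper1] *[OF Un_upper2]
    by (simp add: lookup_add power_add prod.distrib)
qed

lemma mpoly_eval_mult: "mpoly_eval (f * g) P = mpoly_eval f P * mpoly_eval g P"
proof -
  have "f * g = (\<Sum>a\<in>Poly_Mapping.keys f. \<Sum>b\<in>Poly_Mapping.keys g.
      Poly_Mapping.single (a + b) (Poly_Mapping.lookup f a * Poly_Mapping.lookup g b))"
    by (subst mpoly_as_sum[of f], subst mpoly_as_sum[of g])
       (simp add: sum_product mult_single)
  then show ?thesis
    by (simp add: mpoly_eval_sum mpoly_eval_single monomial_eval_add)
       (simp add: mpoly_eval_def sum_product mult.assoc mult.left_commute)
qed

lemma mpoly_eval_uminus: "mpoly_eval (- f) P = - mpoly_eval f P"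
  using mpoly_eval_add[of f "- f" P] by (simp add: eq_neg_iff_add_eq_0 add.commute)

lemma ideal_vanishing: "ideal {f \<in> mpoly_carrier n. mpoly_eval f P = 0} (mpoly_algebra n)"
proof -
  interpret cring "mpoly_algebra n" by (rule cring_mpoly_algebra)
  have inv: "\<ominus>\<^bsub>mpoly_algebra n\<^esub> f = - f" if "f \<in> mpoly_carrier n" for f
    using that by (intro minus_equality) (auto simp: mpoly_carrier_closed)
  show ?thesis
  proof (rule idealI)
    show "subgroup {f \<in> mpoly_carrier n. mpoly_eval f P = 0} (add_monoid (mpoly_algebra n))"
      unfolding subgroup_def a_inv_def[symmetric]
      by (auto simp: inv mpoly_carrier_closed mpoly_eval_add mpoly_eval_uminus)
  qed (auto simp: ring_axioms mpoly_carrier_closed mpoly_eval_mult)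
qed

lemma zero_locus_Un_Int:
  assumes "ideal I (mpoly_algebra n)" "ideal J (mpoly_algebra n)"
  shows "zero_locus n I \<union> zero_locus n J = zero_locus n (I \<inter> J)"
proof (intro equalityI subsetI)
  fix P assume P: "P \<in> zero_locus n (I \<inter> J)"
  show "P \<in> zero_locus n I \<union> zero_locus n J"
  proof (rule ccontr)
    assume "\<not> ?thesis"
    then obtain f g where fg: "f \<in> I" "g \<in> J" "mpoly_eval f P \<noteq> 0" "mpoly_eval g P \<noteq> 0"
      using P by (auto simp: zero_locus_def)
    have "f \<in> mpoly_carrier n" "g \<in> mpoly_carrier n"
      using fg assms ideal.Icarr by fastforce+
    then have "f * g \<in> I \<inter> J"
      using ideal.I_r_closed[OF assms(1) fg(1)] ideal.I_l_closed[OF assms(2) fg(2)] by simp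
    then have "mpoly_eval (f * g) P = 0" using P by (auto simp: zero_locus_def)
    then show False using fg by (simp add: mpoly_eval_mult)
  qed
qed (auto simp: zero_locus_def)

lemma zero_locus_genideal:
  assumes "S \<subseteq> mpoly_carrier n"
  shows "zero_locus n (Idl\<^bsub>mpoly_algebra n\<^esub> S) = zero_locus n S"
proof -
  interpret cring "mpoly_algebra n" by (rule cring_mpoly_algebra)
  have "S \<subseteq> Idl\<^bsub>mpoly_algebra n\<^esub> S" using assms by (intro genideal_self) simp
  moreover have "Idl\<^bsub>mpoly_algebra n\<^esub> S \<subseteq> {f \<in> mpoly_carrier n. mpoly_eval f P = 0}"
    if "P \<in> zero_locus n S" for P
    using that assms by (intro genideal_minimal ideal_vanishing) (auto simp: zero_locus_def)
  ultimately show ?thesis by (fastforce simp: zero_locus_def)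
qed

lemma istopology_zariski:
  "istopology (\<lambda>U. U \<subseteq> affine_points n \<and>
     algebraic_subset n (affine_points n - U :: (nat \<Rightarrow> 'k::field) set))"
  unfolding istopology_def
proof (intro conjI allI impI)
  interpret cring "mpoly_algebra n :: ('k, 'k mpoly) module" by (rule cring_mpoly_algebra)
  fix U V :: "(nat \<Rightarrow> 'k) set"
  assume "U \<subseteq> affine_points n \<and> algebraic_subset n (affine_points n - U)"
    and "V \<subseteq> affine_points n \<and> algebraic_subset n (affine_points n - V)"
  then obtain I J where IJ: "ideal I (mpoly_algebra n)" "ideal J (mpoly_algebra n)"
      "affine_points n - U = zero_locus n I" "affine_points n - V = zero_locus n J"
    by (auto simp: algebraic_subset_def)
  have "affine_points n - (U \<inter> V) = zero_locus n (I \<inter> J)"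
    using zero_locus_Un_Int[OF IJ(1,2)] IJ(3,4) by blast
  then show "algebraic_subset n (affine_points n - (U \<inter> V))"
    using i_intersect[OF IJ(1,2)] unfolding algebraic_subset_def by blast
next
  interpret cring "mpoly_algebra n :: ('k, 'k mpoly) module" by (rule cring_mpoly_algebra)
  fix \<K> :: "(nat \<Rightarrow> 'k) set set"
  assume "\<forall>U\<in>\<K>. U \<subseteq> affine_points n \<and> algebraic_subset n (affine_points n - U)"
  then obtain I where I: "\<And>U. U \<in> \<K> \<Longrightarrow> ideal (I U) (mpoly_algebra n)"
      "\<And>U. U \<in> \<K> \<Longrightarrow> affine_points n - U = zero_locus n (I U)"
    unfolding algebraic_subset_def by metis
  have sub: "(\<Union>U\<in>\<K>. I U) \<subseteq> mpoly_carrier n"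
    using I(1) ideal.Icarr by fastforce
  have "affine_points n - \<Union>\<K> = zero_locus n (\<Union>U\<in>\<K>. I U)"
    using I(2) unfolding zero_locus_def by blast
  then have "affine_points n - \<Union>\<K> = zero_locus n (Idl\<^bsub>mpoly_algebra n\<^esub> (\<Union>U\<in>\<K>. I U))"
    by (simp add: zero_locus_genideal[OF sub])
  then show "algebraic_subset n (affine_points n - \<Union>\<K>)"
    using genideal_ideal[of "\<Union>U\<in>\<K>. I U"] sub unfolding algebraic_subset_def by auto
qed auto

lemma algebraic_subset_subset: "algebraic_subset n V \<Longrightarrow> V \<subseteq> affine_points n"
  by (auto simp: algebraic_subset_def zero_locus_def)

lemma openin_zariski:
  "openin (zariski n) U \<longleftrightarrow> U \<subseteq> affine_points n \<and> algebraic_subset n (affine_points n - U)"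
  unfolding zariski_def by (subst topology_inverse'[OF istopology_zariski]) simp

lemma topspace_zariski: "topspace (zariski n) = (affine_points n :: (nat \<Rightarrow> 'k::field) set)"
proof -
  interpret cring "mpoly_algebra n :: ('k, 'k mpoly) module" by (rule cring_mpoly_algebra)
  have "{} = zero_locus n (mpoly_carrier n :: 'k mpoly set)"
  proof -
    have "mpoly_eval 1 P = 1" for P :: "nat \<Rightarrow> 'k"
      using mpoly_eval_single[of 0 1 P] by simp
    then show ?thesis
      using mpoly_carrier_1[of n, where 'a = 'k] by (fastforce simp: zero_locus_def)
  qed
  then have "openin (zariski n) (affine_points n :: (nat \<Rightarrow> 'k) set)"
    using oneideal unfolding openin_zariski algebraic_subset_def by auto
  then show ?thesis
    using openin_zariski openin_subset by (metis openin_topspace subset_antisym)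
qed

lemma closedin_zariski: "closedin (zariski n) V \<longleftrightarrow> algebraic_subset n V"
  using algebraic_subset_subset[of n V]
  by (auto simp: closedin_def topspace_zariski openin_zariski double_diff)

end

theory Submission
  imports Defs
begin

text \<open>If \<open>m\<close> is an essential maximal ideal, every \<open>X\<^sub>i\<close> is congruent modulo \<open>m\<close> to a scalar \<open>P\<^sub>i\<close>,
  hence every \<open>f\<close> is congruent to \<open>f(P)\<close>, and \<open>m\<close> is the ideal of the point \<open>P\<close>. Consequently the
  equiradical of \<open>I\<close> is the ideal of all polynomials vanishing on \<open>\<Z>(I)\<close>, and the three
  correspondences are those of the Galois connection between ideals and algebraic sets.\<close>

section \<open>Generators of the polynomial algebra\<close>

lemma mpoly_eval_const [simp]: "mpoly_eval (Poly_Mapping.single 0 c) P = c"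
  by (simp add: mpoly_eval_single)

lemma mpoly_eval_1 [simp]: "mpoly_eval 1 P = 1"
  using mpoly_eval_const[of 1 P] by simp

lemma mpoly_eval_minus: "mpoly_eval (f - g) P = mpoly_eval f P - mpoly_eval g P"
  using mpoly_eval_add[of f "- g" P] by (simp add: mpoly_eval_uminus)

lemma mpoly_carrier_minus: "f \<in> mpoly_carrier n \<Longrightarrow> g \<in> mpoly_carrier n \<Longrightarrow> f - g \<in> mpoly_carrier n"
  using mpoly_carrier_add[of f n "- g"] by (simp add: mpoly_carrier_uminus)

definition mpoly_var :: "nat \<Rightarrow> 'k::field mpoly" where
  "mpoly_var i = Poly_Mapping.single (Poly_Mapping.single i 1) 1"

lemma mpoly_carrier_var: "i < n \<Longrightarrow> mpoly_var i \<in> mpoly_carrier n"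
  by (simp add: mpoly_carrier_def mpoly_var_def)

lemma mpoly_eval_var [simp]: "mpoly_eval (mpoly_var i) P = P i"
  by (simp add: mpoly_var_def mpoly_eval_single)

text \<open>Induction on the total degree: a nonconstant monomial loses one factor
  \<open>mpoly_var i\<close>, while the coefficient \<open>c\<close> stays fixed. The case
  \<open>var\<close> also provides membership in \<open>mpoly_carrier n\<close>, which product rules
  ask for.\<close>

lemma monomial_induct [consumes 1, case_names const var]:
  fixes c :: "'k::field"
  assumes "Poly_Mapping.keys a \<subseteq> {..<n}"
    and const: "Q (Poly_Mapping.single 0 c)"
    and var: "\<And>i b. i < n \<Longrightarrow> Poly_Mapping.single b c \<in> mpoly_carrier n \<Longrightarrow> Q (Poly_Mapping.single b c) \<Longrightarrow>
      Q (mpoly_var i * Poly_Mapping.single b c)"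
  shows "Q (Poly_Mapping.single a c)"
  using assms(1)
proof (induction "\<Sum>i<n. Poly_Mapping.lookup a i" arbitrary: a rule: less_induct)
  case less
  show ?case
  proof (cases "a = 0")
    case False
    then obtain i where i: "i \<in> Poly_Mapping.keys a" by (metis ex_in_conv keys_eq_empty)
    then have "i < n" using less.prems by auto
    \<comment> \<open>Subtraction of exponents is truncated; it is exact here because
      \<open>i\<close> lies in the support of \<open>a\<close>, so its exponent is at least
      1.\<close>
    define b where "b = a - Poly_Mapping.single i 1"
    have a: "a = Poly_Mapping.single i 1 + b"
      using i by (intro poly_mapping_eqI)
        (auto simp: b_def lookup_add lookup_minus lookup_single when_def in_keys_iff)
    have b: "Poly_Mapping.keys b \<subseteq> {..<n}"
      using less.prems by (auto simp: a lookup_add in_keys_iff subset_iff)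
    have "(\<Sum>i<n. Poly_Mapping.lookup b i) < (\<Sum>i<n. Poly_Mapping.lookup a i)"
      using \<open>i < n\<close> by (intro sum_strict_mono_ex1) (auto simp: a lookup_add intro!: bexI[of _ i])
    from less.hyps[OF this b] have "Q (mpoly_var i * Poly_Mapping.single b c)"
      using b \<open>i < n\<close> by (intro var) (auto simp: mpoly_carrier_def split: if_splits)
    then show ?thesis by (simp add: a mpoly_var_def mult_single)
  qed (simp add: const)
qed

text \<open>Expresses that constants and variables generate k[X_1,...,X_n] as a ring, so that a
  congruence modulo an ideal can be checked on generators.\<close>

lemma mpoly_carrier_induct [consumes 1, case_names const var add mult]:
  assumes f: "f \<in> mpoly_carrier n"
    and const: "\<And>c. Q (Poly_Mapping.single 0 c)"
    and var: "\<And>i. i < n \<Longrightarrow> Q (mpoly_var i)"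
    and add: "\<And>f g. f \<in> mpoly_carrier n \<Longrightarrow> g \<in> mpoly_carrier n \<Longrightarrow> Q f \<Longrightarrow> Q g \<Longrightarrow> Q (f + g)"
    and mult: "\<And>f g. f \<in> mpoly_carrier n \<Longrightarrow> g \<in> mpoly_carrier n \<Longrightarrow> Q f \<Longrightarrow> Q g \<Longrightarrow> Q (f * g)"
  shows "Q f"
proof -
  have single: "Q (Poly_Mapping.single a c)" if "Poly_Mapping.keys a \<subseteq> {..<n}" for a c
    using that by (induction rule: monomial_induct) (auto intro: const var mult mpoly_carrier_var)
  \<comment> \<open>Partial sums of the terms of \<open>f\<close> are treated one by one. Membership
    is carried along because the case \<open>add\<close> demands it of both summands.\<close>
  have "(\<Sum>a\<in>A. Poly_Mapping.single a (Poly_Mapping.lookup f a)) \<in> mpoly_carrier n \<and>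
      Q (\<Sum>a\<in>A. Poly_Mapping.single a (Poly_Mapping.lookup f a))"
    if "finite A" "A \<subseteq> Poly_Mapping.keys f" for A
    using that
  proof (induction A rule: finite_induct)
    case empty
    then show ?case using const[of 0] by (simp add: mpoly_carrier_0)
  next
    case (insert a A)
    then have "Poly_Mapping.keys a \<subseteq> {..<n}" using f by (auto simp: mpoly_carrier_def)
    moreover from this have "Poly_Mapping.single a (Poly_Mapping.lookup f a) \<in> mpoly_carrier n"
      by (simp add: mpoly_carrier_def)
    ultimately show ?case using insert by (auto intro: add mpoly_carrier_add single)
  qed
  from this[of "Poly_Mapping.keys f"] show ?thesis by (simp flip: mpoly_as_sum)
qed

lemma mpoly_ideal_closed:
  assumes "ideal I (mpoly_algebra n)"
  shows "I \<subseteq> mpoly_carrier n" "0 \<in> I"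
    "\<And>f g. f \<in> I \<Longrightarrow> g \<in> I \<Longrightarrow> f + g \<in> I"
    "\<And>f g. f \<in> I \<Longrightarrow> g \<in> mpoly_carrier n \<Longrightarrow> f * g \<in> I"
    "\<And>f g. f \<in> I \<Longrightarrow> g \<in> I \<Longrightarrow> f - g \<in> I"
proof -
  interpret ideal I "mpoly_algebra n" by fact
  show "I \<subseteq> mpoly_carrier n" using Icarr by auto
  show "0 \<in> I" using additive_subgroup.zero_closed[OF is_additive_subgroup] by simp
  show add: "f + g \<in> I" if "f \<in> I" "g \<in> I" for f g
    using additive_subgroup.a_closed[OF is_additive_subgroup that] by simp
  show mult: "f * g \<in> I" if "f \<in> I" "g \<in> mpoly_carrier n" for f g
    using I_r_closed that by simp
  \<comment> \<open>Here \<open>f - g\<close> is read as \<open>f + g * (- 1)\<close>, so the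
    previous two closure rules suffice.\<close>
  show "f - g \<in> I" if "f \<in> I" "g \<in> I" for f g
    using add[OF that(1) mult[OF that(2) mpoly_carrier_uminus[OF mpoly_carrier_1]]] by simp
qed

section \<open>Ideals of points and the equiradical\<close>

text \<open>The other half of the Galois connection with \<open>zero_locus\<close>. For empty
  \<open>V\<close> it is the whole carrier, in accordance with an equiradical over no essential
  maximal ideal.\<close>

definition vanishing_ideal :: "nat \<Rightarrow> (nat \<Rightarrow> 'k::field) set \<Rightarrow> 'k mpoly set" where
  "vanishing_ideal n V = {f \<in> mpoly_carrier n. \<forall>P\<in>V. mpoly_eval f P = 0}"

lemma vanishing_ideal_singleton:
  "vanishing_ideal n {P} = {f \<in> mpoly_carrier n. mpoly_eval f P = 0}"
  by (simp add: vanishing_ideal_def)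

section \<open>Residue rings: essential means that every polynomial is congruent to a
  constant\<close>

lemma coset_eq_iff:
  assumes I: "ideal I (mpoly_algebra n)" and f: "f \<in> mpoly_carrier n" and g: "g \<in> mpoly_carrier n"
  shows "I +>\<^bsub>mpoly_algebra n\<^esub> f = I +>\<^bsub>mpoly_algebra n\<^esub> g \<longleftrightarrow> f - g \<in> I"
proof -
  have coset: "I +>\<^bsub>mpoly_algebra n\<^esub> h = (\<lambda>i. i + h) ` I" for h
    by (auto simp: a_r_coset_def')
  note c = mpoly_ideal_closed[OF I]
  show ?thesis
  proof
    assume "I +>\<^bsub>mpoly_algebra n\<^esub> f = I +>\<^bsub>mpoly_algebra n\<^esub> g"
    moreover have "f \<in> (\<lambda>i. i + f) ` I" using c(2) by force
    ultimately show "f - g \<in> I" unfolding coset by (auto simp: image_iff)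
  next
    assume fg: "f - g \<in> I"
    have "i + f \<in> (\<lambda>i. i + g) ` I" if "i \<in> I" for i
      using c(3)[OF that fg] by (intro image_eqI[of _ _ "i + (f - g)"]) auto
    moreover have "i + g \<in> (\<lambda>i. i + f) ` I" if "i \<in> I" for i
      using c(5)[OF that fg] by (intro image_eqI[of _ _ "i - (f - g)"]) auto
    ultimately show "I +>\<^bsub>mpoly_algebra n\<^esub> f = I +>\<^bsub>mpoly_algebra n\<^esub> g" unfolding coset by blast
  qed
qed

text \<open>The structural morphism into the quotient is always an injective ring homomorphism, so
  being an isomorphism amounts to surjectivity. Later arguments can then work with \<open>m\<close>
  alone, without the quotient.\<close>

lemma essential_maximal_iff:
  fixes m :: "'k::field mpoly set"
  assumes m: "maximalideal m (mpoly_algebra n)"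
  shows "essential_maximal ring_of_type_algebra (mpoly_algebra n) m \<longleftrightarrow>
    (\<forall>f\<in>mpoly_carrier n. \<exists>c. f - Poly_Mapping.single 0 c \<in> m)"
proof -
  let ?R = "mpoly_algebra n :: ('k, 'k mpoly) module"
  let ?h = "\<lambda>c. m +>\<^bsub>?R\<^esub> (c \<odot>\<^bsub>?R\<^esub> \<one>\<^bsub>?R\<^esub>)"
  interpret maximalideal m ?R by (fact m)
  note c = mpoly_ideal_closed[OF ideal_axioms]
  have hom: "?h \<in> ring_hom (ring_of_type_algebra :: 'k ring) (?R Quot m)"
  proof -
    have "(\<lambda>c. Poly_Mapping.single 0 c) \<in> ring_hom (ring_of_type_algebra :: 'k ring) ?R"
      by (rule ring_hom_memI)
        (auto simp: ring_of_type_algebra_def mpoly_carrier_const single_add mult_single)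
    from ring_hom_trans[OF this rcos_ring_hom] show ?thesis by (simp add: comp_def)
  qed
  \<comment> \<open>A nonzero constant is a unit and cannot lie in the proper ideal
    \<open>m\<close>; this is the kernel computation behind \<open>inj\<close>.\<close>
  have const: "c = 0" if "Poly_Mapping.single 0 c \<in> m" for c
  proof (rule ccontr)
    assume "c \<noteq> 0"
    then have "1 \<in> m"
      using c(4)[OF that mpoly_carrier_const[of "inverse c"]] by (simp add: mult_single)
    then have "mpoly_carrier n \<subseteq> m" using c(4)[of 1] by auto
    then show False using I_notcarr c(1) by auto
  qed
  have inj: "inj ?h"
    by (auto simp: inj_def coset_eq_iff[OF ideal_axioms] mpoly_carrier_const
        simp flip: single_diff dest!: const)
  have "carrier (?R Quot m) = (\<lambda>f. m +>\<^bsub>?R\<^esub> f) ` mpoly_carrier n"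
    by (auto simp: FactRing_def A_RCOSETS_def')
  moreover have "range ?h \<subseteq> carrier (?R Quot m)"
    using hom by (auto simp: ring_hom_def ring_of_type_algebra_def)
  \<comment> \<open>Constants already land in the quotient, so equality of the two images only
    requires that each coset contain a constant.\<close>
  moreover have "range h = q ` S \<longleftrightarrow> (\<forall>f\<in>S. \<exists>c. q f = h c)" if "range h \<subseteq> q ` S"
    for h :: "'k \<Rightarrow> 'k mpoly set" and q :: "'k mpoly \<Rightarrow> 'k mpoly set" and S
  proof
    assume "range h = q ` S"
    then have "q f \<in> range h" if "f \<in> S" for f using that by simp
    then show "\<forall>f\<in>S. \<exists>c. q f = h c" by blast
  qed (use that in auto)
  ultimately have "range ?h = carrier (?R Quot m) \<longleftrightarrow>
      (\<forall>f\<in>mpoly_carrier n. \<exists>c. m +>\<^bsub>?R\<^esub> f = ?h c)"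
    by presburger
  also have "\<dots> \<longleftrightarrow> (\<forall>f\<in>mpoly_carrier n. \<exists>c. f - Poly_Mapping.single 0 c \<in> m)"
    by (simp add: coset_eq_iff[OF ideal_axioms] mpoly_carrier_const)
  finally show ?thesis
    using m hom inj unfolding essential_maximal_def ring_iso_def bij_betw_def
    by (simp add: ring_of_type_algebra_def)
qed

section \<open>Points and essential maximal ideals\<close>

lemma maximalideal_point: "maximalideal (vanishing_ideal n {P}) (mpoly_algebra n)"
proof (rule maximalidealI)
  show "ideal (vanishing_ideal n {P}) (mpoly_algebra n)"
    unfolding vanishing_ideal_singleton by (rule ideal_vanishing)
  have "1 \<notin> vanishing_ideal n {P}"
    by (simp add: vanishing_ideal_def)
  then show "carrier (mpoly_algebra n) \<noteq> vanishing_ideal n {P}"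
    using mpoly_carrier_1 by auto
next
  fix J assume J: "ideal J (mpoly_algebra n)" "vanishing_ideal n {P} \<subseteq> J"
  note c = mpoly_ideal_closed[OF J(1)]
  have "J = carrier (mpoly_algebra n)" if ne: "J \<noteq> vanishing_ideal n {P}"
  proof -
    \<comment> \<open>A strictly larger ideal contains some \<open>f\<close> not vanishing at
      \<open>P\<close>. Subtracting \<open>f - f(P)\<close>, which vanishes at \<open>P\<close>,
      leaves a nonzero constant in \<open>J\<close>, hence 1.\<close>
    obtain f where f: "f \<in> J" "mpoly_eval f P \<noteq> 0"
      using ne J(2) c(1) by (auto simp: vanishing_ideal_def)
    let ?c = "mpoly_eval f P"
    have "f - Poly_Mapping.single 0 ?c \<in> J"
      using f c(1) J(2) by (auto simp: vanishing_ideal_def mpoly_eval_minus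
          intro!: mpoly_carrier_minus mpoly_carrier_const)
    from c(5)[OF f(1) this] have "Poly_Mapping.single 0 ?c \<in> J" by simp
    from c(4)[OF this mpoly_carrier_const[of "inverse ?c"]] have "1 \<in> J"
      using f(2) by (simp add: mult_single)
    then show "J = carrier (mpoly_algebra n)" using c(1) c(4)[of 1] by auto
  qed
  then show "J = vanishing_ideal n {P} \<or> J = carrier (mpoly_algebra n)" by blast
qed

lemma essential_maximal_point:
  "essential_maximal ring_of_type_algebra (mpoly_algebra n) (vanishing_ideal n {P})"
  unfolding essential_maximal_iff[OF maximalideal_point]
proof
  fix f :: "'a mpoly" assume "f \<in> mpoly_carrier n"
  then show "\<exists>c. f - Poly_Mapping.single 0 c \<in> vanishing_ideal n {P}"
    by (intro exI[of _ "mpoly_eval f P"])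
      (simp add: vanishing_ideal_def mpoly_eval_minus mpoly_carrier_minus mpoly_carrier_const)
qed

lemma essential_maximal_iff_point:
  fixes m :: "'k::field mpoly set"
  shows "essential_maximal ring_of_type_algebra (mpoly_algebra n) m \<longleftrightarrow>
    (\<exists>P\<in>affine_points n. m = vanishing_ideal n {P})"
proof
  assume ess: "essential_maximal ring_of_type_algebra (mpoly_algebra n) m"
  then have "maximalideal m (mpoly_algebra n)" by (simp add: essential_maximal_def)
  then interpret maximalideal m "mpoly_algebra n" .
  note c = mpoly_ideal_closed[OF ideal_axioms]
  have "\<forall>i<n. \<exists>c. mpoly_var i - Poly_Mapping.single 0 c \<in> m"
    using ess by (simp add: essential_maximal_iff[OF maximalideal_axioms] mpoly_carrier_var)
  then obtain p where p: "\<And>i. i < n \<Longrightarrow> mpoly_var i - Poly_Mapping.single 0 (p i) \<in> m" by metis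
  \<comment> \<open>Restricting makes \<open>P\<close> extensional, as membership in
    \<open>affine_points n\<close> requires.\<close>
  define P where "P = restrict p {..<n}"
  have congr: "f - Poly_Mapping.single 0 (mpoly_eval f P) \<in> m" if "f \<in> mpoly_carrier n" for f
    using that
  proof (induction rule: mpoly_carrier_induct)
    case (const d)
    then show ?case using c(2) by simp
  next
    case (var i)
    then show ?case using p by (simp add: P_def)
  next
    case (add f g)
    show ?case using c(3)[OF add(3,4)] by (simp add: mpoly_eval_add single_add algebra_simps)
  next
    case (mult f g)
    let ?s = "Poly_Mapping.single (0 :: nat \<Rightarrow>\<^sub>0 nat)"
    \<comment> \<open>The usual splitting fg - f(P)g(P) = (f - f(P))g + (g - g(P))f(P) puts the
      difference into \<open>m\<close>.\<close>
    have "f * g - ?s (mpoly_eval (f * g) P) =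
        (f - ?s (mpoly_eval f P)) * g + (g - ?s (mpoly_eval g P)) * ?s (mpoly_eval f P)"
      by (simp add: mpoly_eval_mult mult_single algebra_simps)
    then show ?case
      using c(3)[OF c(4)[OF mult(3,2)] c(4)[OF mult(4) mpoly_carrier_const]] by simp
  qed
  \<comment> \<open>If f(P) = 0, the congruence reads \<open>f \<in> m\<close>. Since the point
    ideal is maximal and \<open>m\<close> is proper, the inclusion is an equality.\<close>
  have "vanishing_ideal n {P} \<subseteq> m"
    using congr by (fastforce simp: vanishing_ideal_def)
  then have "m = vanishing_ideal n {P}"
    using maximalideal.I_maximal[OF maximalideal_point ideal_axioms] c(1) I_notcarr by auto
  moreover have "P \<in> affine_points n" by (simp add: P_def affine_points_def)
  ultimately show "\<exists>P\<in>affine_points n. m = vanishing_ideal n {P}" by blast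
qed (auto simp: essential_maximal_point)

text \<open>By \<open>essential_maximal_iff_point\<close>, the ideals being intersected are exactly
  those of the points of Z(I). If there are no such points, both sides are the whole
  carrier.\<close>

lemma equiradical_eq_vanishing_ideal:
  assumes "I \<subseteq> mpoly_carrier n"
  shows "equiradical ring_of_type_algebra (mpoly_algebra n) I = vanishing_ideal n (zero_locus n I)"
proof -
  have "I \<subseteq> vanishing_ideal n {P} \<longleftrightarrow> (\<forall>f\<in>I. mpoly_eval f P = 0)" for P
    using assms by (auto simp: vanishing_ideal_def)
  then have "{m. essential_maximal ring_of_type_algebra (mpoly_algebra n) m \<and> I \<subseteq> m} =
      (\<lambda>P. vanishing_ideal n {P}) ` zero_locus n I"
    by (auto simp: essential_maximal_iff_point zero_locus_def)
  then show ?thesis by (auto simp: equiradical_def vanishing_ideal_def)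
qed

text \<open>Identifies the essential ideals with the closed elements on the ideal side of the Galois
  connection.\<close>

lemma essential_ideal_iff:
  "essential_ideal ring_of_type_algebra (mpoly_algebra n) I \<longleftrightarrow>
     ideal I (mpoly_algebra n) \<and> I = vanishing_ideal n (zero_locus n I)"
proof (cases "ideal I (mpoly_algebra n)")
  case True
  then show ?thesis
    by (simp add: essential_ideal_def equiradical_eq_vanishing_ideal[OF mpoly_ideal_closed(1)])
qed (simp add: essential_ideal_def)

section \<open>The Galois connection\<close>

lemma ideal_vanishing_ideal:
  fixes V :: "(nat \<Rightarrow> 'k::field) set"
  shows "ideal (vanishing_ideal n V) (mpoly_algebra n)"
proof -
  interpret cring "mpoly_algebra n :: ('k, 'k mpoly) module" by (rule cring_mpoly_algebra)
  show ?thesis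
  \<comment> \<open>The empty set is separate because \<open>i_Intersect\<close> needs a nonempty
    family of ideals.\<close>
  proof (cases "V = {}")
    case True
    then show ?thesis using oneideal by (simp add: vanishing_ideal_def)
  next
    case False
    then have "vanishing_ideal n V = \<Inter> ((\<lambda>P. vanishing_ideal n {P}) ` V)"
      by (auto simp: vanishing_ideal_def)
    then show ?thesis
      using False by (auto simp: vanishing_ideal_singleton intro!: i_Intersect ideal_vanishing)
  qed
qed

text \<open>Writing V = Z(I), every element of \<open>I\<close> vanishes on \<open>V\<close>, so a
  common zero of the vanishing ideal of \<open>V\<close> is a zero of \<open>I\<close>; the other
  inclusion is immediate.\<close>

lemma zero_locus_vanishing_ideal:
  assumes "algebraic_subset n V"
  shows "zero_locus n (vanishing_ideal n V) = V"
proof -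
  obtain I where "ideal I (mpoly_algebra n)" "V = zero_locus n I"
    using assms by (auto simp: algebraic_subset_def)
  then show ?thesis
    using mpoly_ideal_closed(1) by (fastforce simp: zero_locus_def vanishing_ideal_def)
qed

lemma essential_vanishing_ideal:
  "algebraic_subset n V \<Longrightarrow>
    essential_ideal ring_of_type_algebra (mpoly_algebra n) (vanishing_ideal n V)"
  by (simp add: essential_ideal_iff ideal_vanishing_ideal zero_locus_vanishing_ideal)

text \<open>Passing to the generated ideal does not change the zeros. This serves for the
  hypersurface of a single polynomial in the irreducibility argument.\<close>

lemma algebraic_zero_locus:
  fixes S :: "'k::field mpoly set"
  assumes "S \<subseteq> mpoly_carrier n"
  shows "algebraic_subset n (zero_locus n S)"
proof -
  interpret cring "mpoly_algebra n :: ('k, 'k mpoly) module" by (rule cring_mpoly_algebra)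
  show ?thesis
    using assms genideal_ideal[of S] zero_locus_genideal[OF assms]
    unfolding algebraic_subset_def by auto
qed

lemma zero_locus_point:
  assumes P: "P \<in> affine_points n"
  shows "zero_locus n (vanishing_ideal n {P}) = {P}"
proof -
  have "Q = P" if "Q \<in> zero_locus n (vanishing_ideal n {P})" for Q
  proof (rule extensionalityI)
    show "Q \<in> extensional {..<n}" "P \<in> extensional {..<n}"
      using that P by (auto simp: zero_locus_def affine_points_def PiE_def)
    fix i assume "i \<in> {..<n}"
    \<comment> \<open>The polynomial X_i - P_i forces the i-th coordinate of \<open>Q\<close>. Both
      points are extensional, so the coordinates below \<open>n\<close> determine them.\<close>
    then have "mpoly_var i - Poly_Mapping.single 0 (P i) \<in> vanishing_ideal n {P}"
      by (simp add: vanishing_ideal_def mpoly_eval_minus mpoly_carrier_minus mpoly_carrier_var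
          mpoly_carrier_const)
    then have "mpoly_eval (mpoly_var i - Poly_Mapping.single 0 (P i)) Q = 0"
      using that by (auto simp: zero_locus_def)
    then show "Q i = P i" by (simp add: mpoly_eval_minus)
  qed
  then show ?thesis using P by (auto simp: zero_locus_def vanishing_ideal_def)
qed

section \<open>Prime ideals and irreducible algebraic sets\<close>

lemma closedin_subvariety:
  assumes "algebraic_subset n V"
  shows "closedin (subtopology (zariski n) V) C \<longleftrightarrow> algebraic_subset n C \<and> C \<subseteq> V"
  using closedin_closed_subtopology[of "zariski n" V C] assms by (simp add: closedin_zariski)

lemma prime_vanishing_ideal_iff:
  fixes V :: "(nat \<Rightarrow> 'k::field) set"
  assumes V: "algebraic_subset n V"
  shows "primeideal (vanishing_ideal n V) (mpoly_algebra n) \<longleftrightarrow> irreducible_in (zariski n) V"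
proof
  assume "primeideal (vanishing_ideal n V) (mpoly_algebra n)"
  then interpret primeideal "vanishing_ideal n V" "mpoly_algebra n" .
  have False if CD: "algebraic_subset n C" "algebraic_subset n D" "V = C \<union> D" "V \<noteq> C" "V \<noteq> D" for C D
  proof -
    \<comment> \<open>Otherwise the vanishing ideal of \<open>E\<close> lies in that of
      \<open>V\<close>; taking zero loci gives \<open>V \<subseteq> E\<close>, against properness of
      \<open>E\<close>.\<close>
    have "\<exists>f\<in>vanishing_ideal n E. f \<notin> vanishing_ideal n V"
      if E: "algebraic_subset n E" "E \<subseteq> V" "V \<noteq> E" for E
      using zero_locus_vanishing_ideal[OF E(1)] zero_locus_vanishing_ideal[OF V] E(2,3)
      unfolding zero_locus_def by blast
    from this[of C] this[of D] obtain f g where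
      fg: "f \<in> vanishing_ideal n C" "f \<notin> vanishing_ideal n V"
        "g \<in> vanishing_ideal n D" "g \<notin> vanishing_ideal n V"
      using CD by blast
    \<comment> \<open>The product vanishes on both pieces \<open>C\<close> and \<open>D\<close>,
      hence on \<open>V\<close>, although neither factor does; primality forbids this.\<close>
    then have "f * g \<in> vanishing_ideal n V" "f \<in> mpoly_carrier n" "g \<in> mpoly_carrier n"
      using CD(3) by (auto simp: vanishing_ideal_def mpoly_eval_mult mpoly_carrier_mult)
    then show False using I_prime[of f g] fg by auto
  qed
  moreover have "V \<noteq> {}" using I_notcarr by (auto simp: vanishing_ideal_def)
  ultimately show "irreducible_in (zariski n) V"
    using algebraic_subset_subset[OF V]
    by (auto simp: irreducible_in_def topspace_zariski closedin_subvariety[OF V])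
next
  assume irr: "irreducible_in (zariski n) V"
  interpret cring "mpoly_algebra n :: ('k, 'k mpoly) module" by (rule cring_mpoly_algebra)
  show "primeideal (vanishing_ideal n V) (mpoly_algebra n)"
  proof (rule primeidealI)
    show "carrier (mpoly_algebra n) \<noteq> vanishing_ideal n V"
    proof -
      obtain P where "P \<in> V" using irr by (auto simp: irreducible_in_def)
      then have "1 \<notin> vanishing_ideal n V"
        by (auto simp: vanishing_ideal_def)
      then show ?thesis using mpoly_carrier_1 by auto
    qed
  next
    fix f g :: "'k mpoly"
    assume "f \<in> carrier (mpoly_algebra n)" "g \<in> carrier (mpoly_algebra n)"
      and fg: "f \<otimes>\<^bsub>mpoly_algebra n\<^esub> g \<in> vanishing_ideal n V"
    then have carr: "f \<in> mpoly_carrier n" "g \<in> mpoly_carrier n" by simp_all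
    have closed: "closedin (subtopology (zariski n) V) (V \<inter> zero_locus n {h})"
      if "h \<in> mpoly_carrier n" for h
      using that algebraic_zero_locus[of "{h}" n]
      by (auto simp: closedin_subtopology closedin_zariski)
    \<comment> \<open>At each point of \<open>V\<close> one of the factors vanishes, since k is a
      field. Irreducibility then makes one of the two closed pieces all of \<open>V\<close>.\<close>
    have "V = V \<inter> zero_locus n {f} \<union> V \<inter> zero_locus n {g}"
      using fg algebraic_subset_subset[OF V]
      by (fastforce simp: vanishing_ideal_def zero_locus_def mpoly_eval_mult)
    then have "V = V \<inter> zero_locus n {f} \<or> V = V \<inter> zero_locus n {g}"
      using irr closed[OF carr(1)] closed[OF carr(2)] unfolding irreducible_in_def by blast
    then show "f \<in> vanishing_ideal n V \<or> g \<in> vanishing_ideal n V"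
      using carr unfolding vanishing_ideal_def zero_locus_def by blast
  qed (rule ideal_vanishing_ideal is_cring)+
qed

text \<open>Common frame for the three correspondences: on essential ideals
  \<open>vanishing_ideal n\<close> is an order-reversing left inverse of
  \<open>zero_locus n\<close>, which gives injectivity and the order equivalence. Only the image
  remains to be computed in each case.\<close>

lemma order_reversing_bij_betw_zero_locus:
  assumes essential: "\<And>I. I \<in> \<A> \<Longrightarrow> essential_ideal ring_of_type_algebra (mpoly_algebra n) I"
    and image: "zero_locus n ` \<A> = \<B>"
  shows "order_reversing_bij_betw (zero_locus n) \<A> \<B>"
proof -
  have eq: "I = vanishing_ideal n (zero_locus n I)" if "I \<in> \<A>" for I
    using essential[OF that] by (simp add: essential_ideal_iff)
  then have "inj_on (zero_locus n) \<A>" by (metis inj_onI)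
  moreover have "I \<subseteq> J \<longleftrightarrow> zero_locus n J \<subseteq> zero_locus n I" if "I \<in> \<A>" "J \<in> \<A>" for I J
  proof
    assume "zero_locus n J \<subseteq> zero_locus n I"
    then have "vanishing_ideal n (zero_locus n I) \<subseteq> vanishing_ideal n (zero_locus n J)"
      by (auto simp: vanishing_ideal_def)
    then show "I \<subseteq> J" using eq that by simp
  qed (auto simp: zero_locus_def)
  ultimately show ?thesis using image by (simp add: order_reversing_bij_betw_def bij_betw_def)
qed

theorem proposition2p20:
  fixes n :: nat
  shows
    "order_reversing_bij_betw (zero_locus n :: 'k::field mpoly set \<Rightarrow> (nat \<Rightarrow> 'k) set)
       {I. essential_ideal ring_of_type_algebra (mpoly_algebra n) I}
       {V. algebraic_subset n V} \<and>
     order_reversing_bij_betw (zero_locus n :: 'k mpoly set \<Rightarrow> (nat \<Rightarrow> 'k) set)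
       {I. essential_ideal ring_of_type_algebra (mpoly_algebra n) I \<and>
           primeideal I (mpoly_algebra n)}
       {V. algebraic_subset n V \<and> irreducible_in (zariski n) V} \<and>
     order_reversing_bij_betw (zero_locus n :: 'k mpoly set \<Rightarrow> (nat \<Rightarrow> 'k) set)
       {I. essential_maximal ring_of_type_algebra (mpoly_algebra n) I}
       {{P} | P. P \<in> affine_points n}"
proof (intro conjI order_reversing_bij_betw_zero_locus)
  let ?Z = "zero_locus n :: 'k mpoly set \<Rightarrow> (nat \<Rightarrow> 'k) set"
  let ?ess = "essential_ideal ring_of_type_algebra (mpoly_algebra n) :: 'k mpoly set \<Rightarrow> bool"
  \<comment> \<open>\<open>alg\<close> and \<open>V\<close> say that the two maps of the Galois
    connection are mutually inverse between essential ideals and algebraic subsets.\<close>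
  have alg: "algebraic_subset n (?Z I)" "vanishing_ideal n (?Z I) = I" if "?ess I" for I
    using that by (auto simp: essential_ideal_iff algebraic_subset_def)
  have V: "?ess (vanishing_ideal n V)" "?Z (vanishing_ideal n V) = V" if "algebraic_subset n V" for V
    using that by (simp_all add: essential_vanishing_ideal zero_locus_vanishing_ideal)
  show "?Z ` {I. ?ess I} = {V. algebraic_subset n V}"
    using alg V by (auto intro!: image_eqI)
  show "?Z ` {I. ?ess I \<and> primeideal I (mpoly_algebra n)} =
      {V. algebraic_subset n V \<and> irreducible_in (zariski n) V}"
  proof (intro equalityI subsetI)
    \<comment> \<open>With W = Z(I), the essential ideal \<open>I\<close> is the vanishing ideal of
      \<open>W\<close>, so its primality is irreducibility of \<open>W\<close>.\<close>
    fix W assume "W \<in> ?Z ` {I. ?ess I \<and> primeideal I (mpoly_algebra n)}"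
    then show "W \<in> {V. algebraic_subset n V \<and> irreducible_in (zariski n) V}"
      using alg prime_vanishing_ideal_iff[of n W] by auto
  next
    fix W :: "(nat \<Rightarrow> 'k) set"
    assume "W \<in> {V. algebraic_subset n V \<and> irreducible_in (zariski n) V}"
    then show "W \<in> ?Z ` {I. ?ess I \<and> primeideal I (mpoly_algebra n)}"
      using V prime_vanishing_ideal_iff[of n W] by (intro image_eqI[of _ _ "vanishing_ideal n W"]) auto
  qed
  have "{I. essential_maximal ring_of_type_algebra (mpoly_algebra n) I} =
      (\<lambda>P. vanishing_ideal n {P}) ` (affine_points n :: (nat \<Rightarrow> 'k) set)"
    by (auto simp: essential_maximal_iff_point)
  then show "?Z ` {I. essential_maximal ring_of_type_algebra (mpoly_algebra n) I} =
      {{P} | P. P \<in> affine_points n}"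
    using zero_locus_point[where 'a = 'k] by (auto simp: image_image image_iff)
next
  \<comment> \<open>The frame asks for essential ideals, so the agreement of both notions of
    essential on maximal ideals is used here.\<close>
  fix I :: "'k mpoly set"
  assume "I \<in> {I. essential_maximal ring_of_type_algebra (mpoly_algebra n) I}"
  then show "essential_ideal ring_of_type_algebra (mpoly_algebra n) I"
    using essential_maximal_iff_essential_ideal essential_maximal_def by blast
qed auto

end
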